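(* Let $\mu\ge2$ and suppose the instance is $\mu$-impartial. Then Greedy with Rounded Values with parameter $\mu$ is $O(\log^2\mu)$-competitive, i.e., the optimal Nash welfare is at most $O(\log^2\mu)$ times the Nash welfare of the algorithm's allocation.
   Context: There are $N$ agents and $T$ divisible items arriving online in the order $t=1,\dots,T$. Item $t$ has supply $s_t>0$ and agent $i$ has value $v_{it}\ge 0$ per unit of item $t$. An allocation is a non-negative vector $(x_{it})$ with $\sum_{i} x_{it}\le s_t$; agent $i$'s utility is $u_i=\sum_t x_{it}v_{it}$, and the Nash welfare is $(\prod_{i=1}^N u_i)^{1/N}$. An allocation with utilities $(u_i)$ is $\mu$-impartial if $u_i\le\mu u_j$ for all $i,j$; an instance is $\mu$-impartial if every Nash welfare maximizing allocation is $\mu$-impartial. Myopic Greedy: for each arriving item $t$, choose $(x_{it})_i$ maximizing $\sum_{i=1}^N\log\big(\sum_{t'<t}v_{it'}x_{it'}+v_{it}x_{it}\big)$ subject to $\sum_i x_{it}\le s_t$, $x_{it}\ge0$. Greedy with Rounded Values with parameter $\mu$: let $L=\lceil\log_2\mu\rceil$. For each arriving item $t$, let $\bar v_t=\max_i v_{it}$ and create sub-items $(t,1),\dots,(t,L)$, each with supply $s_t/L$, where agent $i$'s value for sub-item $(t,j)$ is $\bar v_t/2^j$ if $v_{it}\ge\bar v_t/2^j$ and $0$ otherwise. The sub-items are fed, in the order $(1,1),\dots,(1,L),(2,1),\dots$, to Myopic Greedy, which allocates $x_{i(t,j)}$; agent $i$ then receives $x_{it}=\sum_{j=1}^Lx_{i(t,j)}$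 of item $t$.
   Formalization: Myopic Greedy's objective sums only over agents with positive value for the arriving item; with all agents, an agent of zero utility not valuing the item makes the sum minus infinity for every choice, so any choice is a maximizer and the bound fails. *)

theory Defs
  imports Complex_Main "HOL-Library.Extended_Real"
begin

(* Agents are i < N and items are t < T, both 0-based; item t has supply s t, and
   v i t, x i t are agent i's value per unit of item t and the amount of it she receives. *)

definition valid_instance :: "nat \<Rightarrow> nat \<Rightarrow> (nat \<Rightarrow> real) \<Rightarrow> (nat \<Rightarrow> nat \<Rightarrow> real) \<Rightarrow> bool" where
  "valid_instance N T s v \<longleftrightarrow> (\<forall>t<T. s t > 0) \<and> (\<forall>i<N. \<forall>t<T. v i t \<ge> 0)"

definition feasible_split :: "nat \<Rightarrow> real \<Rightarrow> (nat \<Rightarrow> real) \<Rightarrow> bool" where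
  "feasible_split N c y \<longleftrightarrow> (\<forall>i<N. y i \<ge> 0) \<and> (\<Sum>i<N. y i) \<le> c"

definition allocation :: "nat \<Rightarrow> nat \<Rightarrow> (nat \<Rightarrow> real) \<Rightarrow> (nat \<Rightarrow> nat \<Rightarrow> real) \<Rightarrow> bool" where
  "allocation N T s x \<longleftrightarrow> (\<forall>t<T. feasible_split N (s t) (\<lambda>i. x i t))"

definition utility :: "nat \<Rightarrow> (nat \<Rightarrow> nat \<Rightarrow> real) \<Rightarrow> (nat \<Rightarrow> nat \<Rightarrow> real) \<Rightarrow> nat \<Rightarrow> real" where
  "utility T v x i = (\<Sum>t<T. x i t * v i t)"

definition nash_welfare :: "nat \<Rightarrow> nat \<Rightarrow> (nat \<Rightarrow> nat \<Rightarrow> real) \<Rightarrow> (nat \<Rightarrow> nat \<Rightarrow> real) \<Rightarrow> real" where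
  "nash_welfare N T v x = root N (\<Prod>i<N. utility T v x i)"

definition optimal_nash_welfare ::
  "nat \<Rightarrow> nat \<Rightarrow> (nat \<Rightarrow> real) \<Rightarrow> (nat \<Rightarrow> nat \<Rightarrow> real) \<Rightarrow> real" where
  "optimal_nash_welfare N T s v = (SUP x\<in>{x. allocation N T s x}. nash_welfare N T v x)"

definition nash_maximizing ::
  "nat \<Rightarrow> nat \<Rightarrow> (nat \<Rightarrow> real) \<Rightarrow> (nat \<Rightarrow> nat \<Rightarrow> real) \<Rightarrow> (nat \<Rightarrow> nat \<Rightarrow> real) \<Rightarrow> bool" where
  "nash_maximizing N T s v x \<longleftrightarrow>
     allocation N T s x \<and>
     (\<forall>y. allocation N T s y \<longrightarrow> nash_welfare N T v y \<le> nash_welfare N T v x)"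

definition impartial_allocation ::
  "real \<Rightarrow> nat \<Rightarrow> nat \<Rightarrow> (nat \<Rightarrow> nat \<Rightarrow> real) \<Rightarrow> (nat \<Rightarrow> nat \<Rightarrow> real) \<Rightarrow> bool" where
  "impartial_allocation \<mu> N T v x \<longleftrightarrow>
     (\<forall>i<N. \<forall>j<N. utility T v x i \<le> \<mu> * utility T v x j)"

definition impartial_instance ::
  "real \<Rightarrow> nat \<Rightarrow> nat \<Rightarrow> (nat \<Rightarrow> real) \<Rightarrow> (nat \<Rightarrow> nat \<Rightarrow> real) \<Rightarrow> bool" where
  "impartial_instance \<mu> N T s v \<longleftrightarrow>
     (\<forall>x. nash_maximizing N T s v x \<longrightarrow> impartial_allocation \<mu> N T v x)"

(* Only ever applied to u \<ge> 0.  The library has ln 0 = 0, while here log 0 must be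
   minus infinity. *)
definition log_ereal :: "real \<Rightarrow> ereal" where
  "log_ereal u = (if u > 0 then ereal (ln u) else - \<infinity>)"

(* The objective of one step, as a function of the split y of item t.  An agent with
   v i t = 0 contributes a term that does not depend on y; it is left out because it may be
   minus infinity, in which case the sum over all agents would be minus infinity for every y
   and would not single out a decision.  See full_objective below. *)
definition greedy_objective ::
  "nat \<Rightarrow> (nat \<Rightarrow> nat \<Rightarrow> real) \<Rightarrow> (nat \<Rightarrow> nat \<Rightarrow> real) \<Rightarrow> nat \<Rightarrow> (nat \<Rightarrow> real) \<Rightarrow> ereal" where
  "greedy_objective N v x t y =
     (\<Sum>i | i < N \<and> v i t > 0. log_ereal ((\<Sum>t'<t. v i t' * x i t') + v i t * y i))"

lemma full_objective:
  assumes "\<And>i. i < N \<Longrightarrow> v i t \<ge> 0"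
  shows "(\<Sum>i<N. log_ereal ((\<Sum>t'<t. v i t' * x i t') + v i t * y i)) =
         greedy_objective N v x t y +
         (\<Sum>i | i < N \<and> v i t = 0. log_ereal (\<Sum>t'<t. v i t' * x i t'))"
proof -
  let ?f = "\<lambda>i. log_ereal ((\<Sum>t'<t. v i t' * x i t') + v i t * y i)"
  have "{..<N} = {i. i < N \<and> v i t > 0} \<union> {i. i < N \<and> v i t = 0}"
    using assms by (force simp: less_le)
  then have "(\<Sum>i<N. ?f i) =
      sum ?f ({i. i < N \<and> v i t > 0} \<union> {i. i < N \<and> v i t = 0})"
    by simp
  also have "\<dots> = sum ?f {i. i < N \<and> v i t > 0} + sum ?f {i. i < N \<and> v i t = 0}"
    by (rule sum.union_disjoint) auto
  also have "sum ?f {i. i < N \<and> v i t = 0} =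
      (\<Sum>i | i < N \<and> v i t = 0. log_ereal (\<Sum>t'<t. v i t' * x i t'))"
    by (rule sum.cong) auto
  finally show ?thesis by (simp add: greedy_objective_def)
qed

(* x is a possible outcome of Myopic Greedy; ties are broken arbitrarily. *)
definition myopic_greedy ::
  "nat \<Rightarrow> nat \<Rightarrow> (nat \<Rightarrow> real) \<Rightarrow> (nat \<Rightarrow> nat \<Rightarrow> real) \<Rightarrow> (nat \<Rightarrow> nat \<Rightarrow> real) \<Rightarrow> bool" where
  "myopic_greedy N T s v x \<longleftrightarrow>
     (\<forall>t<T. feasible_split N (s t) (\<lambda>i. x i t) \<and>
        (\<forall>y. feasible_split N (s t) y \<longrightarrow>
           greedy_objective N v x t y \<le> greedy_objective N v x t (\<lambda>i. x i t)))"

definition num_levels :: "real \<Rightarrow> nat" where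
  "num_levels \<mu> = nat \<lceil>log 2 \<mu>\<rceil>"

(* For 1 \<le> j \<le> L, the sub-item (t, j) is numbered t * L + (j - 1), so that the sub-items
   are 0, ..., T * L - 1 in lexicographic order; sub-item k is (k div L, k mod L + 1). *)
definition rounded_supply :: "nat \<Rightarrow> (nat \<Rightarrow> real) \<Rightarrow> nat \<Rightarrow> real" where
  "rounded_supply L s k = s (k div L) / real L"

definition max_value :: "nat \<Rightarrow> (nat \<Rightarrow> nat \<Rightarrow> real) \<Rightarrow> nat \<Rightarrow> real" where
  "max_value N v t = Max ((\<lambda>i. v i t) ` {..<N})"

definition rounded_value :: "nat \<Rightarrow> nat \<Rightarrow> (nat \<Rightarrow> nat \<Rightarrow> real) \<Rightarrow> nat \<Rightarrow> nat \<Rightarrow> real" where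
  "rounded_value N L v i k =
     (let t = k div L; w = max_value N v t / 2 ^ (k mod L + 1)
      in if v i t \<ge> w then w else 0)"

definition greedy_rounded_values ::
  "real \<Rightarrow> nat \<Rightarrow> nat \<Rightarrow> (nat \<Rightarrow> real) \<Rightarrow> (nat \<Rightarrow> nat \<Rightarrow> real) \<Rightarrow> (nat \<Rightarrow> nat \<Rightarrow> real) \<Rightarrow> bool" where
  "greedy_rounded_values \<mu> N T s v x \<longleftrightarrow>
     (let L = num_levels \<mu> in
      \<exists>z. myopic_greedy N (T * L) (rounded_supply L s) (rounded_value N L v) z \<and>
          (\<forall>i<N. \<forall>t<T. x i t = (\<Sum>j=1..L. z i (t * L + (j - 1)))))"

lemma bdd_above_nash_welfare:
  assumes "N \<ge> 1" "valid_instance N T s v"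
  shows "bdd_above (nash_welfare N T v ` {x. allocation N T s x})"
proof (rule bdd_aboveI2)
  fix x assume "x \<in> {x. allocation N T s x}"
  then have x: "\<And>t i. t < T \<Longrightarrow> i < N \<Longrightarrow> x i t \<ge> 0"
      "\<And>t. t < T \<Longrightarrow> (\<Sum>i<N. x i t) \<le> s t"
    by (auto simp: allocation_def feasible_split_def)
  have v: "\<And>i t. i < N \<Longrightarrow> t < T \<Longrightarrow> v i t \<ge> 0"
    using assms by (auto simp: valid_instance_def)
  have le: "x i t \<le> s t" if "i < N" "t < T" for i t
    using member_le_sum[of i "{..<N}" "\<lambda>i. x i t"] x that by force
  have "(\<Prod>i<N. utility T v x i) \<le> (\<Prod>i<N. \<Sum>t<T. s t * v i t)"
    unfolding utility_def
    by (intro prod_mono conjI sum_nonneg sum_mono mult_right_mono mult_nonneg_nonneg)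
      (use x v le in auto)
  then show "nash_welfare N T v x \<le> root N (\<Prod>i<N. \<Sum>t<T. s t * v i t)"
    unfolding nash_welfare_def using assms by (intro real_root_le_mono) auto
qed

end

theory Submission
  imports Defs "HOL-Analysis.Analysis"
begin

text \<open>Exchanging a small amount of an item between two agents shows that in an optimal
  \<open>\<mu>\<close>-impartial allocation only agents valuing the item within a factor \<open>\<mu>\<close> of the maximum
  receive any of it. Hence handing an agent her optimal share of every sub-item yields a rounded
  utility \<open>b i\<close> of at least a \<open>1 / (2 * L)\<close> fraction of the optimal one, and it remains to
  compare Myopic Greedy on the sub-items with this benchmark.

  There Greedy fills water levels, and a potential argument bounds
  \<open>\<Sum>i. b i * \<phi> (u i)\<close> by \<open>\<Sum>i. \<Phi> (u i) - \<Phi> 0\<close> whenever \<open>\<Phi>\<close> is concave with derivative \<open>\<phi>\<close>.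
  Let \<open>\<beta>\<close> be the least \<open>b i\<close>, so that \<open>\<beta> \<le> b i \<le> \<mu> * \<beta>\<close>. Taking \<open>\<phi> a = 1 / (\<beta> + a)\<close>, cut off at \<open>\<mu> * \<beta>\<close>,
  bounds the mean of \<open>b i / (\<beta> + u i)\<close> by \<open>1 + ln (1 + \<mu>)\<close>; taking \<open>\<phi> a = 1 / sqrt a\<close>, cut off at
  \<open>\<beta>\<close>, bounds the mean of \<open>1 + sqrt (\<beta> / u i)\<close>, which controls the agents whose utility is
  far below \<open>\<beta>\<close>. Both turn into bounds on products by the AM-GM inequality.\<close>

section \<open>Exchange arguments for products over agents\<close>

lemma prod_fun_upd_less:
  fixes f :: "'a \<Rightarrow> real"
  assumes "finite A" "i \<in> A" "\<And>k. k \<in> A \<Longrightarrow> f k > 0" "f i < b"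
  shows "prod f A < prod (f(i := b)) A"
proof -
  have "prod f (A - {i}) > 0"
    using assms by (intro prod_pos) auto
  moreover have "prod f A = f i * prod f (A - {i})"
    using assms by (simp add: prod.remove)
  moreover have "prod (f(i := b)) A = b * prod f (A - {i})"
    using assms by (simp add: prod.remove)
  ultimately show ?thesis
    using assms(4) by simp
qed

text \<open>Only two factors change; the product of the others is positive and cancels, so
  optimality of a product reduces to comparing two agents.\<close>

lemma prod_exchange_le_iff:
  fixes f :: "'a \<Rightarrow> real"
  assumes "finite A" "i \<in> A" "j \<in> A" "i \<noteq> j" "\<And>k. k \<in> A \<Longrightarrow> f k > 0"
  shows "prod (f(i := a, j := b)) A \<le> prod f A \<longleftrightarrow> a * b \<le> f i * f j"
proof -
  have split: "prod g A = g i * g j * prod g (A - {i} - {j})" for g :: "'a \<Rightarrow> real"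
    using assms by (simp add: prod.remove[of A i] prod.remove[of "A - {i}" j])
  have "prod (f(i := a, j := b)) (A - {i} - {j}) = prod f (A - {i} - {j})"
    by (intro prod.cong) auto
  moreover have "prod f (A - {i} - {j}) > 0"
    using assms by (intro prod_pos) auto
  ultimately show ?thesis
    using assms(4) by (simp add: split)
qed

lemma feasible_split_exchange:
  assumes y: "feasible_split N c y" and ij: "i < N" "j < N" "i \<noteq> j"
    and e: "0 \<le> e" "e \<le> y i"
  shows "feasible_split N c (y(i := y i - e, j := y j + e))"
proof -
  have split: "sum g {..<N} = g i + g j + sum g ({..<N} - {i} - {j})" for g :: "nat \<Rightarrow> real"
    using ij by (simp add: sum.remove[of "{..<N}" i] sum.remove[of "{..<N} - {i}" j])
  have "sum (y(i := y i - e, j := y j + e)) ({..<N} - {i} - {j}) = sum y ({..<N} - {i} - {j})"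
    by (intro sum.cong) auto
  then have "sum (y(i := y i - e, j := y j + e)) {..<N} = sum y {..<N}"
    using ij by (simp add: split)
  then show ?thesis
    using y e ij by (auto simp: feasible_split_def)
qed

text \<open>Supply that is unassigned or lies with agents outside \<open>A\<close> could be handed
  to a member of \<open>A\<close>, which would raise the product strictly.\<close>

lemma product_maximizer_exhausts:
  fixes U y :: "nat \<Rightarrow> real"
  assumes A: "A \<subseteq> {..<N}" "A \<noteq> {}" and w: "w > 0"
    and y: "feasible_split N c y" and pos: "\<And>i. i \<in> A \<Longrightarrow> U i + w * y i > 0"
    and max: "\<And>y'. feasible_split N c y' \<Longrightarrow>
      (\<Prod>i\<in>A. U i + w * y' i) \<le> (\<Prod>i\<in>A. U i + w * y i)"
  shows "sum y A = c"
proof (rule ccontr)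
  assume "sum y A \<noteq> c"
  have fin: "finite A"
    using A finite_subset by blast
  have "sum y A \<le> sum y {..<N}"
    using A y by (intro sum_mono2) (auto simp: feasible_split_def)
  with \<open>sum y A \<noteq> c\<close> y have slack: "sum y A < c"
    by (auto simp: feasible_split_def)
  obtain i where i: "i \<in> A"
    using A by blast
  \<comment> \<open>Agents outside \<open>A\<close> are stripped as well, so the extra amount for
    \<open>i\<close> covers both unassigned and misdirected supply.\<close>
  define y' where "y' k = (if k = i then y i + (c - sum y A) else if k \<in> A then y k else 0)" for k
  have "sum y' {..<N} = sum y' A"
    using A i by (intro sum.mono_neutral_right) (auto simp: y'_def)
  also have "\<dots> = y' i + sum y' (A - {i})"
    using fin i by (simp add: sum.remove)
  also have "sum y' (A - {i}) = sum y (A - {i})"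
    by (intro sum.cong) (auto simp: y'_def)
  also have "y' i + sum y (A - {i}) = c"
    using sum.remove[OF fin i, of y] by (simp add: y'_def)
  finally have "feasible_split N c y'"
    using y A i slack by (auto simp: feasible_split_def y'_def subset_iff)
  note max[OF this]
  also have "(\<Prod>k\<in>A. U k + w * y' k) =
      prod ((\<lambda>k. U k + w * y k)(i := U i + w * (y i + (c - sum y A)))) A"
    by (intro prod.cong) (auto simp: y'_def)
  finally show False
    using prod_fun_upd_less[OF fin i, of "\<lambda>k. U k + w * y k"
        "U i + w * (y i + (c - sum y A))"] pos w slack
    by (auto simp: not_less[symmetric])
qed

text \<open>Water filling: \<open>l\<close> is the lowest final utility in \<open>A\<close>. A
  recipient above another member of \<open>A\<close> could pass a little to that member and raise
  the product, so recipients sit exactly at \<open>l\<close>.\<close>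

lemma product_maximizer_level:
  fixes U y :: "nat \<Rightarrow> real"
  assumes A: "A \<subseteq> {..<N}" "A \<noteq> {}" and w: "w > 0" and c: "c > 0"
    and y: "feasible_split N c y" and pos: "\<And>i. i \<in> A \<Longrightarrow> U i + w * y i > 0"
    and max: "\<And>y'. feasible_split N c y' \<Longrightarrow>
      (\<Prod>i\<in>A. U i + w * y' i) \<le> (\<Prod>i\<in>A. U i + w * y i)"
  obtains l where "l > 0" "\<And>i. i \<in> A \<Longrightarrow> l \<le> U i + w * y i"
    "\<And>i. i \<in> A \<Longrightarrow> y i > 0 \<Longrightarrow> U i + w * y i = l"
proof -
  let ?f = "\<lambda>i. U i + w * y i"
  have fin: "finite A"
    using A finite_subset by blast
  have recipient_le: "?f i \<le> ?f j" if i: "i \<in> A" "y i > 0" and j: "j \<in> A" for i j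
  proof (rule ccontr)
    assume less: "\<not> ?thesis"
    then have "i \<noteq> j" by auto
    define d where "d = ?f i - ?f j"
    have "d > 0" using less by (simp add: d_def)
    \<comment> \<open>A transfer of \<open>d / (2 * w)\<close> would equalize the two agents; going
      no further keeps the gain \<open>w * e * (d - w * e)\<close> positive.\<close>
    define e where "e = min (y i) (d / (2 * w))"
    have e: "0 < e" "e \<le> y i" "w * e < d"
      using i w \<open>d > 0\<close> by (auto simp: e_def min_def field_simps)
    have "feasible_split N c (y(i := y i - e, j := y j + e))"
      using y i j A e \<open>i \<noteq> j\<close> by (intro feasible_split_exchange) auto
    note max[OF this]
    also have "(\<Prod>k\<in>A. U k + w * (y(i := y i - e, j := y j + e)) k) =
        prod (?f(i := ?f i - w * e, j := ?f j + w * e)) A"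
      by (intro prod.cong) (auto simp: algebra_simps)
    finally have "(?f i - w * e) * (?f j + w * e) \<le> ?f i * ?f j"
      using prod_exchange_le_iff[of A i j ?f] fin i j \<open>i \<noteq> j\<close> pos by simp
    moreover have "(?f i - w * e) * (?f j + w * e) = ?f i * ?f j + w * e * (d - w * e)"
      by (simp add: d_def algebra_simps)
    moreover have "w * e * (d - w * e) > 0"
      using e w by simp
    ultimately show False by linarith
  qed
  define l where "l = Min (?f ` A)"
  have l_le: "l \<le> ?f i" if "i \<in> A" for i
    using fin that by (simp add: l_def)
  have "l \<in> ?f ` A"
    using fin A by (auto simp: l_def intro: Min_in)
  then obtain m where m: "m \<in> A" "l = ?f m" by blast
  show ?thesis
  proof
    show "l > 0" using m pos by simp
    show "U i + w * y i = l" if "i \<in> A" "y i > 0" for i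
      using recipient_le[OF that m(1)] l_le[OF that(1)] m(2) by simp
  qed (rule l_le)
qed

section \<open>One step of Myopic Greedy and the potential argument\<close>

text \<open>Passes from the extended-real objective to a product, to which the exchange arguments
  apply. Some split makes all interested agents positive, so the optimum is not minus infinity and
  \<open>ln\<close> can be undone.\<close>

lemma myopic_greedy_maximizes_product:
  assumes greedy: "myopic_greedy N T s v x" and t: "t < T" and s: "s t > 0"
    and v: "\<And>i t'. i < N \<Longrightarrow> t' < T \<Longrightarrow> v i t' \<ge> 0"
  defines "A \<equiv> {i. i < N \<and> v i t > 0}" and "U \<equiv> \<lambda>i. \<Sum>t'<t. v i t' * x i t'"
  shows "\<And>i. i \<in> A \<Longrightarrow> U i + v i t * x i t > 0"
    and "\<And>y. feasible_split N (s t) y \<Longrightarrow>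
      (\<Prod>i\<in>A. U i + v i t * y i) \<le> (\<Prod>i\<in>A. U i + v i t * x i t)"
proof -
  have obj: "greedy_objective N v x t y = (\<Sum>i\<in>A. log_ereal (U i + v i t * y i))" for y
    by (simp add: greedy_objective_def A_def U_def)
  have fin: "finite A" by (simp add: A_def)
  have x: "x i t' \<ge> 0" if "i < N" "t' < T" for i t'
    using greedy that by (auto simp: myopic_greedy_def feasible_split_def)
  have U: "U i \<ge> 0" if "i \<in> A" for i
    using that x v t by (auto simp: U_def A_def intro!: sum_nonneg)
  have finite_obj: "(\<Sum>i\<in>A. log_ereal (g i)) = ereal (ln (prod g A))"
    if "\<And>i. i \<in> A \<Longrightarrow> g i > 0" for g
  proof -
    have "(\<Sum>i\<in>A. log_ereal (g i)) = (\<Sum>i\<in>A. ereal (ln (g i)))"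
      using that by (intro sum.cong) (auto simp: log_ereal_def)
    also have "\<dots> = ereal (ln (prod g A))"
      using ln_prod[OF fin, of g] that by (force simp: less_le)
    finally show ?thesis .
  qed
  have opt: "greedy_objective N v x t y \<le> greedy_objective N v x t (\<lambda>i. x i t)"
    if "feasible_split N (s t) y" for y
    using greedy t that by (auto simp: myopic_greedy_def)
  show pos: "U i + v i t * x i t > 0" if i: "i \<in> A" for i
  proof (rule ccontr)
    assume not_pos: "\<not> ?thesis"
    \<comment> \<open>A witness with finite objective: an equal split gives every interested agent a
      positive gain.\<close>
    define y where "y = (\<lambda>_::nat. s t / real N)"
    have "N > 0" using i by (auto simp: A_def)
    then have y: "feasible_split N (s t) y"
      using s by (simp add: y_def feasible_split_def)
    have "U k + v k t * y k > 0" if "k \<in> A" for k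
      using that U[OF that] s \<open>N > 0\<close> by (auto simp: A_def y_def intro!: add_nonneg_pos)
    from finite_obj[OF this] opt[OF y]
    have ge: "ereal (ln (\<Prod>k\<in>A. U k + v k t * y k)) \<le> (\<Sum>k\<in>A. log_ereal (U k + v k t * x k t))"
      by (simp add: obj)
    have "\<bar>\<Sum>k\<in>A. log_ereal (U k + v k t * x k t)\<bar> = \<infinity>"
      unfolding sum_Inf using i fin not_pos by (auto simp: log_ereal_def)
    moreover have "(\<Sum>k\<in>A. log_ereal (U k + v k t * x k t)) \<noteq> \<infinity>"
      unfolding sum_Pinfty by (auto simp: log_ereal_def)
    ultimately have "(\<Sum>k\<in>A. log_ereal (U k + v k t * x k t)) = - \<infinity>"
      by auto
    with ge show False by simp
  qed
  show "(\<Prod>i\<in>A. U i + v i t * y i) \<le> (\<Prod>i\<in>A. U i + v i t * x i t)"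
    if y: "feasible_split N (s t) y" for y
  proof -
    have nonneg: "U i + v i t * y i \<ge> 0" if "i \<in> A" for i
      using that U[OF that] y by (auto simp: A_def feasible_split_def)
    have greedy_pos: "(\<Prod>i\<in>A. U i + v i t * x i t) > 0"
      using pos by (intro prod_pos)
    show ?thesis
    proof (cases "\<forall>i\<in>A. U i + v i t * y i > 0")
      case True
      then have "ln (\<Prod>i\<in>A. U i + v i t * y i) \<le> ln (\<Prod>i\<in>A. U i + v i t * x i t)"
        using opt[OF y] pos by (simp add: obj finite_obj)
      moreover have "(\<Prod>i\<in>A. U i + v i t * y i) > 0"
        using True by (intro prod_pos) auto
      ultimately show ?thesis
        using greedy_pos by simp
    next
      case False
      then have "\<exists>i\<in>A. U i + v i t * y i = 0"
        using nonneg by (meson not_less order_antisym)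
      then have "(\<Prod>i\<in>A. U i + v i t * y i) = 0"
        using fin by (intro prod_zero) auto
      then show ?thesis using greedy_pos by simp
    qed
  qed
qed

text \<open>An item that every agent values at \<open>w\<close> or not at all is used up by filling its
  interested agents to a common level \<open>l\<close>, which bounds all their final utilities from below.
  Charging the benchmark's value for the item at rate \<open>\<phi> l\<close> is therefore paid for by the
  growth of \<open>\<Phi>\<close>, a concave function with derivative \<open>\<phi>\<close>.\<close>
lemma myopic_greedy_potential:
  fixes \<phi> \<Phi> :: "real \<Rightarrow> real"
  assumes greedy: "myopic_greedy N T s v z"
    and s: "\<And>t. t < T \<Longrightarrow> s t > 0"
    and w: "\<And>t. t < T \<Longrightarrow> w t \<ge> 0"
    and v: "\<And>i t. i < N \<Longrightarrow> t < T \<Longrightarrow> v i t = 0 \<or> v i t = w t"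
    and y: "allocation N T s y"
    and \<phi>_nonneg: "\<And>a. \<phi> a \<ge> 0"
    and \<phi>_antimono: "\<And>a b. 0 < a \<Longrightarrow> a \<le> b \<Longrightarrow> \<phi> b \<le> \<phi> a"
    and tangent: "\<And>a b. 0 \<le> a \<Longrightarrow> a \<le> b \<Longrightarrow> 0 < b \<Longrightarrow> \<phi> b * (b - a) \<le> \<Phi> b - \<Phi> a"
  shows "(\<Sum>i<N. utility T v y i * \<phi> (utility T v z i)) \<le>
    (\<Sum>i<N. \<Phi> (utility T v z i) - \<Phi> 0)"
proof -
  have v_nonneg: "v i t \<ge> 0" if "i < N" "t < T" for i t
    using v[OF that] w[OF that(2)] by auto
  have z: "z i t \<ge> 0" if "i < N" "t < T" for i t
    using greedy that by (auto simp: myopic_greedy_def feasible_split_def)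
  define U where "U i t = (\<Sum>t'<t. v i t' * z i t')" for i t
  have U_Suc: "U i (Suc t) = U i t + v i t * z i t" for i t
    by (simp add: U_def)
  have U_T: "utility T v z i = U i T" for i
    by (simp add: U_def utility_def mult.commute)
  have U_mono: "U i t \<le> U i t'" if "i < N" "t \<le> t'" "t' \<le> T" for i t t'
    unfolding U_def using that v_nonneg z by (intro sum_mono2) auto
  have U_0: "U i 0 = 0" for i
    by (simp add: U_def)
  have U_nonneg: "U i t \<ge> 0" if "i < N" "t \<le> T" for i t
    using U_mono[of i 0 t] that by (simp add: U_0)
  have \<Phi>_mono: "\<Phi> a \<le> \<Phi> b" if "0 \<le> a" "a \<le> b" for a b
  proof (cases "b = a")
    case False
    then have "0 \<le> \<phi> b * (b - a)" using \<phi>_nonneg that by simp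
    also have "\<dots> \<le> \<Phi> b - \<Phi> a" using tangent False that by simp
    finally show ?thesis by simp
  qed simp
  have step: "(\<Sum>i<N. y i t * v i t * \<phi> (U i T)) \<le> (\<Sum>i<N. \<Phi> (U i (Suc t)) - \<Phi> (U i t))"
    if t: "t < T" for t
  proof -
    define A where "A = {i. i < N \<and> v i t > 0}"
    have AN: "A \<subseteq> {..<N}" and fin: "finite A" by (auto simp: A_def)
    have increase_nonneg: "\<Phi> (U i t) \<le> \<Phi> (U i (Suc t))" if "i < N" for i
      using that t by (intro \<Phi>_mono U_nonneg U_mono) auto
    have lhs: "(\<Sum>i<N. y i t * v i t * \<phi> (U i T)) = (\<Sum>i\<in>A. y i t * v i t * \<phi> (U i T))"
      using v_nonneg t by (intro sum.mono_neutral_right) (force simp: A_def less_le)+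
    have rhs: "(\<Sum>i\<in>A. \<Phi> (U i (Suc t)) - \<Phi> (U i t)) \<le> (\<Sum>i<N. \<Phi> (U i (Suc t)) - \<Phi> (U i t))"
      using AN increase_nonneg by (intro sum_mono2) auto
    show ?thesis
    proof (cases "A = {}")
      case True
      then show ?thesis using lhs rhs by simp
    next
      case False
      have vA: "v i t = w t" if "i \<in> A" for i
        using that v[of i t] t by (auto simp: A_def)
      then have wt: "w t > 0" using False by (auto simp: A_def)
      note product = myopic_greedy_maximizes_product[OF greedy t s[OF t] v_nonneg,
          folded A_def U_def]
      have zt: "feasible_split N (s t) (\<lambda>i. z i t)"
        using greedy t by (auto simp: myopic_greedy_def)
      have pos: "U i t + w t * z i t > 0" if "i \<in> A" for i
        using product(1)[of i] that by (simp add: vA)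
      have max: "(\<Prod>i\<in>A. U i t + w t * y' i) \<le> (\<Prod>i\<in>A. U i t + w t * z i t)"
        if "feasible_split N (s t) y'" for y'
        using product(2)[of y'] that by (simp add: vA cong: prod.cong)
      have total: "(\<Sum>i\<in>A. z i t) = s t"
        using product_maximizer_exhausts[OF AN False wt zt pos max] .
      obtain l where l: "l > 0" "\<And>i. i \<in> A \<Longrightarrow> l \<le> U i t + w t * z i t"
        "\<And>i. i \<in> A \<Longrightarrow> z i t > 0 \<Longrightarrow> U i t + w t * z i t = l"
        using product_maximizer_level[OF AN False wt s[OF t] zt pos max] by metis
      have "(\<Sum>i\<in>A. y i t * v i t * \<phi> (U i T)) \<le> (\<Sum>i\<in>A. y i t * (w t * \<phi> l))"
      proof (rule sum_mono)
        fix i assume i: "i \<in> A"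
        then have "i < N" by (simp add: A_def)
        have "l \<le> U i (Suc t)"
          using l(2)[OF i] by (simp add: U_Suc vA[OF i])
        also have "\<dots> \<le> U i T"
          using U_mono[OF \<open>i < N\<close>, of "Suc t" T] t by simp
        finally have "\<phi> (U i T) \<le> \<phi> l"
          using l(1) by (rule \<phi>_antimono[rotated])
        moreover have "y i t \<ge> 0"
          using y t \<open>i < N\<close> by (auto simp: allocation_def feasible_split_def)
        ultimately show "y i t * v i t * \<phi> (U i T) \<le> y i t * (w t * \<phi> l)"
          using wt by (simp add: vA[OF i] mult_left_mono mult.assoc)
      qed
      also have "\<dots> = (\<Sum>i\<in>A. y i t) * (w t * \<phi> l)"
        by (simp add: sum_distrib_right)
      also have "\<dots> \<le> s t * (w t * \<phi> l)"
      proof (rule mult_right_mono)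
        have "(\<Sum>i\<in>A. y i t) \<le> (\<Sum>i<N. y i t)"
          using AN y t by (intro sum_mono2) (auto simp: allocation_def feasible_split_def)
        also have "\<dots> \<le> s t"
          using y t by (auto simp: allocation_def feasible_split_def)
        finally show "(\<Sum>i\<in>A. y i t) \<le> s t" .
      qed (use wt \<phi>_nonneg in auto)
      \<comment> \<open>Greedy hands all of \<open>s t\<close> to \<open>A\<close>, so the supply
        that bounded the benchmark's consumption is rewritten as Greedy's own.\<close>
      also have "\<dots> = (\<Sum>i\<in>A. \<phi> l * (w t * z i t))"
        by (simp add: total[symmetric] sum_distrib_left sum_distrib_right mult_ac)
      also have "\<dots> \<le> (\<Sum>i\<in>A. \<Phi> (U i (Suc t)) - \<Phi> (U i t))"
      proof (rule sum_mono)
        fix i assume i: "i \<in> A"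
        then have "i < N" by (simp add: A_def)
        show "\<phi> l * (w t * z i t) \<le> \<Phi> (U i (Suc t)) - \<Phi> (U i t)"
        \<comment> \<open>A recipient ends exactly at \<open>l\<close>, so \<open>tangent\<close> at
          the right endpoint has slope \<open>\<phi> l\<close>; for the others the left side is
          zero.\<close>
        proof (cases "z i t > 0")
          case True
          then have "U i (Suc t) = l"
            using l(3)[OF i] by (simp add: U_Suc vA[OF i])
          moreover have "w t * z i t = U i (Suc t) - U i t"
            by (simp add: U_Suc vA[OF i])
          moreover have "U i t \<le> U i (Suc t)" "0 \<le> U i t"
            using U_mono U_nonneg \<open>i < N\<close> t by auto
          ultimately show ?thesis
            using tangent[of "U i t" "U i (Suc t)"] l(1) by simp
        next
          case False
          then have "z i t = 0" using z[OF \<open>i < N\<close> t] by simp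
          then show ?thesis using increase_nonneg[OF \<open>i < N\<close>] by simp
        qed
      qed
      finally show ?thesis using lhs rhs by simp
    qed
  qed
  have "(\<Sum>i<N. utility T v y i * \<phi> (utility T v z i)) =
      (\<Sum>t<T. \<Sum>i<N. y i t * v i t * \<phi> (U i T))"
    unfolding U_T by (subst sum.swap) (simp add: utility_def sum_distrib_right)
  also have "\<dots> \<le> (\<Sum>t<T. \<Sum>i<N. \<Phi> (U i (Suc t)) - \<Phi> (U i t))"
    by (rule sum_mono) (simp add: step)
  also have "\<dots> = (\<Sum>i<N. \<Phi> (utility T v z i) - \<Phi> 0)"
    by (subst sum.swap)
      (simp add: sum_lessThan_telescope[of "\<lambda>t. \<Phi> (U _ t)"] U_T U_0)
  finally show ?thesis .
qed

section \<open>Existence of a Nash optimum and its first-order condition\<close>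

text \<open>Tychonoff's theorem, carried over to the topology of the function type.\<close>

lemma compact_PiE_UNIV:
  fixes S :: "'i \<Rightarrow> 'a::topological_space set"
  assumes "\<And>i. compact (S i)"
  shows "compact (PiE UNIV S)"
proof -
  have "compactin (product_topology (\<lambda>_. euclidean) UNIV) (PiE UNIV S)"
    using assms by (simp add: compactin_PiE)
  then show ?thesis
    by (simp add: euclidean_product_topology)
qed

lemma continuous_on_entry: "continuous_on S (\<lambda>x::nat \<Rightarrow> nat \<Rightarrow> real. x i t)"
  by (rule continuous_on_product_then_coordinatewise
      [OF continuous_on_product_then_coordinatewise[OF continuous_on_id]])

text \<open>Impartiality of an instance speaks of maximizers only, so it yields information once one
  exists. Compactness of the allocations and continuity of the welfare provide it.\<close>

lemma nash_maximizing_exists: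
  assumes "valid_instance N T s v"
  obtains x where "nash_maximizing N T s v x"
proof -
  \<comment> \<open>Entries outside the \<open>N\<close> by \<open>T\<close> range are pinned to 0,
    since leaving them free would destroy compactness; truncating an allocation to this form does
    not change its welfare.\<close>
  define B where "B = (\<Pi>\<^sub>E i\<in>UNIV. \<Pi>\<^sub>E t\<in>UNIV. if i < N \<and> t < T then {0..s t} else {0})"
  define K where "K = B \<inter> (\<Inter>t\<in>{..<T}. {x. (\<Sum>i<N. x i t) \<le> s t})"
  have s: "s t > 0" if "t < T" for t
    using assms that by (auto simp: valid_instance_def)
  have B: "x \<in> B \<longleftrightarrow> (\<forall>i t. x i t \<in> (if i < N \<and> t < T then {0..s t} else {0}))" for x
    by (simp add: B_def PiE_UNIV_domain Pi_iff)
  have "compact B"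
    unfolding B_def by (intro compact_PiE_UNIV) auto
  then have "compact K"
    unfolding K_def
    by (intro compact_Int_closed closed_INT ballI closed_Collect_le continuous_on_sum
        continuous_on_entry continuous_on_const)
  moreover have "K \<noteq> {}"
  proof -
    have "(\<lambda>i t. 0) \<in> K"
      using s by (auto simp: K_def B less_imp_le)
    then show ?thesis by blast
  qed
  moreover have "continuous_on K (nash_welfare N T v)"
    unfolding nash_welfare_def utility_def
    by (intro continuous_on_real_root continuous_on_prod continuous_on_sum continuous_on_mult
        continuous_on_entry continuous_on_const)
  ultimately obtain x where x: "x \<in> K" and
      max: "\<And>y. y \<in> K \<Longrightarrow> nash_welfare N T v y \<le> nash_welfare N T v x"
    using continuous_attains_sup by meson
  have "nash_welfare N T v y \<le> nash_welfare N T v x" if y: "allocation N T s y" for y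
  proof -
    define y' where "y' i t = (if i < N \<and> t < T then y i t else 0)" for i t
    have y_le: "y i t \<le> s t" if "i < N" "t < T" for i t
    proof -
      have "y i t \<le> (\<Sum>i<N. y i t)"
        using y that by (intro member_le_sum) (auto simp: allocation_def feasible_split_def)
      also have "\<dots> \<le> s t"
        using y that by (auto simp: allocation_def feasible_split_def)
      finally show ?thesis .
    qed
    have "y' \<in> K"
      using y y_le by (auto simp: K_def B y'_def allocation_def feasible_split_def)
    moreover have "nash_welfare N T v y' = nash_welfare N T v y"
      by (simp add: nash_welfare_def utility_def y'_def)
    ultimately show ?thesis using max by metis
  qed
  moreover have "allocation N T s x"
    using x by (auto simp: K_def B allocation_def feasible_split_def split: if_splits)
  ultimately show ?thesis
    using that by (auto simp: nash_maximizing_def)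
qed

lemma utility_update:
  assumes "t < T"
  shows "utility T v (x(i := (x i)(t := c))) i = utility T v x i + (c - x i t) * v i t"
proof -
  have "utility T v (x(i := (x i)(t := c))) i = c * v i t + (\<Sum>k\<in>{..<T} - {t}. x i k * v i k)"
    using assms by (simp add: utility_def sum.remove[of "{..<T}" t])
  moreover have "utility T v x i = x i t * v i t + (\<Sum>k\<in>{..<T} - {t}. x i k * v i k)"
    using assms by (simp add: utility_def sum.remove[of "{..<T}" t])
  ultimately show ?thesis by (simp add: algebra_simps)
qed

text \<open>Otherwise passing a small amount of item \<open>t\<close> from \<open>i\<close> to
  \<open>j\<close> would raise the product to first order. This is the KKT condition that recipients
  of an item have the largest ratio of value to utility.\<close>

lemma nash_maximizing_exchange:
  assumes max: "nash_maximizing N T s v x" and v: "valid_instance N T s v"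
    and pos: "\<And>i. i < N \<Longrightarrow> utility T v x i > 0"
    and i: "i < N" and j: "j < N" and t: "t < T" and x: "x i t > 0"
  shows "v j t * utility T v x i \<le> v i t * utility T v x j"
proof (cases "i = j")
  case False
  let ?u = "utility T v x"
  have alloc: "allocation N T s x"
    using max by (simp add: nash_maximizing_def)
  have v_nonneg: "v i t \<ge> 0" "v j t \<ge> 0"
    using v i j t by (auto simp: valid_instance_def)
  \<comment> \<open>Comparing the products before and after a transfer of \<open>e\<close> and
    dividing by \<open>e\<close> leaves the first-order gain on the left and the second-order loss
    on the right.\<close>
  have exchange: "v j t * ?u i - v i t * ?u j \<le> e * (v i t * v j t)" if e: "0 < e" "e \<le> x i t" for e
  proof -
    define x' where "x' = x(i := (x i)(t := x i t - e), j := (x j)(t := x j t + e))"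
    have "feasible_split N (s r) (\<lambda>k. x' k r)" if "r < T" for r
    proof (cases "r = t")
      case True
      have "(\<lambda>k. x' k t) = (\<lambda>k. x k t)(i := x i t - e, j := x j t + e)"
        using \<open>i \<noteq> j\<close> by (auto simp: x'_def)
      with True show ?thesis
        using feasible_split_exchange[of N "s t" "\<lambda>k. x k t" i j e] alloc i j t e \<open>i \<noteq> j\<close>
        by (auto simp: allocation_def)
    next
      case False
      then have "(\<lambda>k. x' k r) = (\<lambda>k. x k r)"
        by (auto simp: x'_def)
      with that alloc show ?thesis by (simp add: allocation_def)
    qed
    then have "allocation N T s x'"
      by (simp add: allocation_def)
    then have "nash_welfare N T v x' \<le> nash_welfare N T v x"
      using max by (simp add: nash_maximizing_def)
    then have "(\<Prod>k<N. utility T v x' k) \<le> (\<Prod>k<N. ?u k)"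
      using i by (simp add: nash_welfare_def)
    also have "utility T v x' = ?u(i := ?u i - e * v i t, j := ?u j + e * v j t)"
    proof
      fix k
      have "utility T v x' i = utility T v (x(i := (x i)(t := x i t - e))) i"
        "utility T v x' j = utility T v (x(j := (x j)(t := x j t + e))) j"
        using \<open>i \<noteq> j\<close> by (simp_all add: utility_def x'_def)
      moreover have "utility T v x' k = ?u k" if "k \<noteq> i" "k \<noteq> j"
        using that by (simp add: utility_def x'_def)
      ultimately show "utility T v x' k = (?u(i := ?u i - e * v i t, j := ?u j + e * v j t)) k"
        using t by (simp add: utility_update)
    qed
    finally have "(?u i - e * v i t) * (?u j + e * v j t) \<le> ?u i * ?u j"
      using prod_exchange_le_iff[of "{..<N}" i j ?u] i j \<open>i \<noteq> j\<close> pos by simp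
    then have "e * (v j t * ?u i - v i t * ?u j) \<le> e * (e * (v i t * v j t))"
      by (simp add: algebra_simps)
    with e show ?thesis by simp
  qed
  show ?thesis
  proof (rule ccontr)
    assume "\<not> ?thesis"
    then have d: "v j t * ?u i - v i t * ?u j > 0" (is "?d > 0") by simp
    \<comment> \<open>Small enough that the second-order loss is at most half of the gain
      \<open>?d\<close>; the \<open>+ 1\<close> keeps the denominator positive when a value is
      zero.\<close>
    define e where "e = min (x i t) (?d / (2 * (v i t * v j t + 1)))"
    have m: "v i t * v j t \<ge> 0" using v_nonneg by simp
    have e: "0 < e" "e \<le> x i t"
      using x d m by (auto simp: e_def intro!: divide_pos_pos)
    have "?d \<le> e * (v i t * v j t)"
      using exchange[OF e] .
    also have "\<dots> \<le> e * (v i t * v j t + 1)"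
      using e by simp
    also have "\<dots> \<le> ?d / (2 * (v i t * v j t + 1)) * (v i t * v j t + 1)"
      using m by (intro mult_right_mono) (auto simp: e_def)
    also have "\<dots> = ?d / 2"
      using m by (simp add: field_simps)
    finally show False using d by simp
  qed
qed simp

section \<open>The AM-GM bound, and rounding into sub-items\<close>

text \<open>AM-GM with any upper bound \<open>c\<close> on the mean, in power form so that bounds
  for several factors can be multiplied before a root is taken.\<close>

lemma arith_geom_mean_power:
  fixes g :: "'a \<Rightarrow> real"
  assumes "finite A" "\<And>i. i \<in> A \<Longrightarrow> g i \<ge> 0" "sum g A \<le> real (card A) * c"
  shows "prod g A \<le> c ^ card A"
proof (cases "A = {}")
  case False
  define n where "n = card A"
  have n: "n > 0" using assms False by (simp add: n_def card_gt_0_iff)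
  have p: "prod g A \<ge> 0" using assms by (intro prod_nonneg) auto
  have "prod g A powr (1 / n) \<le> (\<Sum>i\<in>A. g i / n)"
    using arith_geom_mean[of A g] assms False by (simp add: n_def)
  also have "\<dots> = sum g A / n"
    by (simp add: sum_divide_distrib)
  also have "\<dots> \<le> c"
    using assms(3) n by (simp add: n_def[symmetric] field_simps)
  finally have "root n (prod g A) \<le> c"
    using root_powr_inverse[OF n p] by simp
  then have "root n (prod g A) ^ n \<le> c ^ n"
    using p by (intro power_mono real_root_ge_zero)
  then show ?thesis
    using real_root_pow_pos2[OF n p] by (simp add: n_def)
qed simp

lemma max_value_ge: "i < N \<Longrightarrow> v i t \<le> max_value N v t"
  by (simp add: max_value_def)

lemma max_value_attained:
  assumes "N \<ge> 1"
  obtains i where "i < N" "max_value N v t = v i t"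
proof -
  have "max_value N v t \<in> (\<lambda>i. v i t) ` {..<N}"
    unfolding max_value_def using assms by (intro Max_in) (auto simp: lessThan_empty_iff)
  with that show ?thesis by blast
qed

lemma rounded_value_sub_item:
  assumes "j < L"
  shows "rounded_value N L v i (t * L + j) =
    (if max_value N v t / 2 ^ Suc j \<le> v i t then max_value N v t / 2 ^ Suc j else 0)"
  using assms by (simp add: rounded_value_def Let_def)

lemma rounded_value_le:
  assumes "v i (k div L) \<ge> 0"
  shows "rounded_value N L v i k \<le> v i (k div L)"
  using assms by (simp add: rounded_value_def Let_def)

text \<open>Halving \<open>b\<close> until it first drops to \<open>a\<close> or below overshoots by
  at most a factor 2. The levels begin at \<open>b / 2\<close>, so even \<open>a = b\<close> loses
  this factor.\<close>

lemma half_le_some_rounding: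
  fixes a b :: real
  assumes "0 \<le> a" "a \<le> b" "b / 2 ^ L \<le> a" "L \<ge> 1"
  shows "\<exists>j<L. b / 2 ^ Suc j \<le> a \<and> a / 2 \<le> b / 2 ^ Suc j"
  using assms(3,4)
proof (induction L)
  case (Suc L)
  show ?case
  proof (cases "b / 2 ^ L \<le> a \<and> L \<ge> 1")
    case True
    with Suc.IH show ?thesis by (auto intro: less_SucI)
  next
    \<comment> \<open>Here \<open>b / 2 ^ Suc L\<close> is the first level at or below
      \<open>a\<close>, so its double is at least \<open>a\<close>; for \<open>L = 0\<close> the
      double is \<open>b\<close> itself.\<close>
    case False
    then have "a \<le> b / 2 ^ L"
      using assms by (cases L) auto
    with Suc.prems show ?thesis
      by (intro exI[of _ L]) (auto simp: field_simps)
  qed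
qed simp

lemma utility_sub_items:
  "utility (T * L) r z i = (\<Sum>t<T. \<Sum>j<L. z i (t * L + j) * r i (t * L + j))"
proof -
  have "utility (T * L) r z i = (\<Sum>t<T. \<Sum>k = t * L..<t * L + L. z i k * r i k)"
    by (simp add: utility_def sum.nat_group)
  also have "\<dots> = (\<Sum>t<T. \<Sum>j<L. z i (t * L + j) * r i (t * L + j))"
  proof (rule sum.cong)
    fix t
    show "(\<Sum>k = t * L..<t * L + L. z i k * r i k) = (\<Sum>j<L. z i (t * L + j) * r i (t * L + j))"
      using sum.shift_bounds_nat_ivl[of "\<lambda>k. z i k * r i k" 0 "t * L" L]
      by (simp add: add.commute lessThan_atLeast0)
  qed simp
  finally show ?thesis .
qed

text \<open>The benchmark spreads each optimal share evenly over the \<open>L\<close> sub-items.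
  Counting only the one whose rounded value lies between \<open>v i t / 2\<close> and
  \<open>v i t\<close> costs a factor \<open>L\<close>, and the rounding costs a factor 2.\<close>

lemma half_utility_le_rounded_utility:
  assumes "L \<ge> 1" and v: "valid_instance N T s v" and x: "allocation N T s x" and i: "i < N"
    and near_max: "\<And>t. t < T \<Longrightarrow> x i t > 0 \<Longrightarrow> max_value N v t / 2 ^ L \<le> v i t"
  shows "utility T v x i / (2 * real L) \<le>
    utility (T * L) (rounded_value N L v) (\<lambda>i k. x i (k div L) / real L) i"
proof -
  let ?r = "rounded_value N L v"
  have item: "x i t * v i t / (2 * real L) \<le> (\<Sum>j<L. x i t / real L * ?r i (t * L + j))"
    if t: "t < T" for t
  proof -
    have v_nonneg: "v i t \<ge> 0"
      using v i t by (auto simp: valid_instance_def)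
    then have max_nonneg: "max_value N v t \<ge> 0"
      using max_value_ge[OF i, of v t] by simp
    have r_nonneg: "?r i (t * L + j) \<ge> 0" if "j < L" for j
      using that max_nonneg by (simp add: rounded_value_sub_item)
    have x_nonneg: "x i t \<ge> 0"
      using x i t by (auto simp: allocation_def feasible_split_def)
    show ?thesis
    proof (cases "x i t > 0")
      case True
      obtain j where j: "j < L" "max_value N v t / 2 ^ Suc j \<le> v i t"
        "v i t / 2 \<le> max_value N v t / 2 ^ Suc j"
        using half_le_some_rounding[OF v_nonneg max_value_ge[OF i] near_max[OF t True] \<open>L \<ge> 1\<close>]
        by blast
      have "v i t / 2 \<le> ?r i (t * L + j)"
        using j by (simp add: rounded_value_sub_item)
      also have "\<dots> \<le> (\<Sum>j<L. ?r i (t * L + j))"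
        using j r_nonneg by (intro member_le_sum) auto
      finally have "x i t / real L * (v i t / 2) \<le> x i t / real L * (\<Sum>j<L. ?r i (t * L + j))"
        using x_nonneg by (intro mult_left_mono) auto
      then show ?thesis
        by (simp add: sum_distrib_left mult.commute)
    qed (use x_nonneg in simp)
  qed
  have "utility T v x i / (2 * real L) = (\<Sum>t<T. x i t * v i t / (2 * real L))"
    by (simp add: utility_def sum_divide_distrib)
  also have "\<dots> \<le> (\<Sum>t<T. \<Sum>j<L. x i t / real L * ?r i (t * L + j))"
    by (rule sum_mono) (rule item, simp)
  finally show ?thesis
    by (simp add: utility_sub_items)
qed

text \<open>Rounding never overstates a value, so a guarantee for Greedy on the sub-items carries
  over to the true utilities.\<close>

lemma rounded_utility_le:
  assumes v: "valid_instance N T s v" and i: "i < N"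
    and z: "\<And>k. k < T * L \<Longrightarrow> z i k \<ge> 0"
    and x: "\<And>t. t < T \<Longrightarrow> x i t = (\<Sum>j=1..L. z i (t * L + (j - 1)))"
  shows "utility (T * L) (rounded_value N L v) z i \<le> utility T v x i"
proof -
  have "(\<Sum>j<L. z i (t * L + j) * rounded_value N L v i (t * L + j)) \<le> x i t * v i t"
    if t: "t < T" for t
  proof -
    have "(\<Sum>j<L. z i (t * L + j) * rounded_value N L v i (t * L + j)) \<le>
        (\<Sum>j<L. z i (t * L + j) * v i t)"
    proof (rule sum_mono)
      fix j assume "j \<in> {..<L}"
      then have j: "j < L" by simp
      have "t * L + j < Suc t * L" using j by simp
      also have "\<dots> \<le> T * L" using t by (intro mult_le_mono1) simp
      finally have "z i (t * L + j) \<ge> 0" by (rule z)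
      moreover have "rounded_value N L v i (t * L + j) \<le> v i t"
        using rounded_value_le[of v i "t * L + j" L N] v i t j by (auto simp: valid_instance_def)
      ultimately show "z i (t * L + j) * rounded_value N L v i (t * L + j) \<le> z i (t * L + j) * v i t"
        by (rule mult_left_mono[rotated])
    qed
    also have "\<dots> = (\<Sum>j=1..L. z i (t * L + (j - 1))) * v i t"
      using sum.atLeast1_atMost_eq[of "\<lambda>j. z i (t * L + (j - 1))" L]
      by (simp add: sum_distrib_right)
    finally show ?thesis using x[OF t] by simp
  qed
  then show ?thesis
    unfolding utility_sub_items utility_def[of T] by (intro sum_mono) simp
qed

section \<open>Product bound for Myopic Greedy against a balanced benchmark\<close>

text \<open>With \<open>m i\<close> the capped utility, \<open>b i\<close> factors as
  \<open>b i / (\<beta> + m i)\<close> times \<open>1 + \<beta> / m i\<close> times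
  \<open>m i\<close>. The mean of the first factor costs the logarithm. The second is bounded
  through \<open>(1 + sqrt (\<beta> / m i))\<^sup>2\<close>, because \<open>1 / a\<close> has no
  antiderivative that is finite at 0 while \<open>1 / sqrt a\<close> does; the square turns 4 into
  16.\<close>

lemma myopic_greedy_competitive:
  assumes greedy: "myopic_greedy N T s v z"
    and s: "\<And>t. t < T \<Longrightarrow> s t > 0"
    and w: "\<And>t. t < T \<Longrightarrow> w t \<ge> 0"
    and v: "\<And>i t. i < N \<Longrightarrow> t < T \<Longrightarrow> v i t = 0 \<or> v i t = w t"
    and y: "allocation N T s y" and b: "\<And>i. i < N \<Longrightarrow> b i \<le> utility T v y i"
    and \<beta>: "\<beta> > 0" "\<And>i. i < N \<Longrightarrow> \<beta> \<le> b i" "\<And>i. i < N \<Longrightarrow> b i \<le> \<mu> * \<beta>" and \<mu>: "\<mu> \<ge> 1"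
  shows "(\<Prod>i<N. b i) \<le> (16 * (1 + ln (1 + \<mu>))) ^ N * (\<Prod>i<N. utility T v z i)"
proof -
  let ?u = "utility T v z"
  define m where "m i = min (?u i) (\<mu> * \<beta>)" for i
  have v_nonneg: "v i t \<ge> 0" if "i < N" "t < T" for i t
    using v[OF that] w[OF that(2)] by auto
  have z: "z i t \<ge> 0" if "i < N" "t < T" for i t
    using greedy that by (auto simp: myopic_greedy_def feasible_split_def)
  have u_nonneg: "?u i \<ge> 0" if "i < N" for i
    unfolding utility_def using that z v_nonneg by (intro sum_nonneg) auto
  have b_pos: "b i > 0" if "i < N" for i
    using \<beta> that by force
  have y_nonneg: "utility T v y i \<ge> 0" if "i < N" for i
    using b[OF that] b_pos[OF that] by simp
  note potential = myopic_greedy_potential[OF greedy s w v y]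
  have \<mu>\<beta>: "\<mu> * \<beta> > 0" "\<beta> \<le> \<mu> * \<beta>" using \<beta>(1) \<mu> by auto
  have u_pos: "?u i > 0" if i: "i < N" for i
  proof (rule ccontr)
    assume "\<not> ?thesis"
    then have u0: "?u i = 0" using u_nonneg[OF i] by simp
    \<comment> \<open>The conditions on monotonicity and tangents concern positive arguments only,
      so \<open>\<phi>\<close> may be the indicator of \<open>a \<le> 0\<close> with constant
      \<open>\<Phi>\<close>. The potential bound then leaves no benchmark value for agents with
      utility zero.\<close>
    define \<phi> \<Phi> :: "real \<Rightarrow> real" where "\<phi> = (\<lambda>a. if a \<le> 0 then 1 else 0)" and "\<Phi> = (\<lambda>a. 0)"
    have "(\<Sum>i<N. utility T v y i * \<phi> (?u i)) \<le> (\<Sum>i<N. \<Phi> (?u i) - \<Phi> 0)"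
      by (rule potential) (auto simp: \<phi>_def \<Phi>_def)
    also have "\<dots> = 0" by (simp add: \<Phi>_def)
    also have "0 < utility T v y i * \<phi> (?u i)"
      using u0 b[OF i] b_pos[OF i] by (simp add: \<phi>_def)
    also have "\<dots> \<le> (\<Sum>i<N. utility T v y i * \<phi> (?u i))"
      using i y_nonneg by (intro member_le_sum) (auto simp: \<phi>_def)
    finally show False by simp
  qed
  have m_pos: "m i > 0" if "i < N" for i
    using u_pos[OF that] \<mu>\<beta> by (simp add: m_def)

  have small: "(\<Sum>i<N. 1 + sqrt (\<beta> / m i)) \<le> real N * 4"
  proof -
    \<comment> \<open>The cut-off at \<open>\<beta>\<close> limits the growth of
      \<open>\<Phi>\<close> to \<open>2 * sqrt \<beta>\<close> per agent; the absolute value keeps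
      \<open>\<phi>\<close> nonnegative everywhere.\<close>
    define \<phi> \<Phi> :: "real \<Rightarrow> real"
      where "\<phi> = (\<lambda>a. if a \<le> \<beta> then 1 / sqrt \<bar>a\<bar> else 0)" and "\<Phi> = (\<lambda>a. 2 * sqrt (min a \<beta>))"
    have "(\<Sum>i<N. utility T v y i * \<phi> (?u i)) \<le> (\<Sum>i<N. \<Phi> (?u i) - \<Phi> 0)"
    proof (rule potential)
      fix a b' :: real assume ab: "0 \<le> a" "a \<le> b'" "0 < b'"
      show "\<phi> b' * (b' - a) \<le> \<Phi> b' - \<Phi> a"
      proof (cases "b' \<le> \<beta>")
        case True
        define p q where "p = sqrt a" and "q = sqrt b'"
        have sq: "a = p\<^sup>2" "b' = q\<^sup>2" and q: "q > 0" using ab by (auto simp: p_def q_def)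
        have "0 \<le> (q - p)\<^sup>2" by simp
        then have "q\<^sup>2 - p\<^sup>2 \<le> (2 * q - 2 * p) * q"
          by (simp add: power2_eq_square algebra_simps)
        then have "(b' - a) / q \<le> 2 * q - 2 * p"
          using q by (simp add: sq pos_divide_le_eq)
        then show ?thesis
          using True ab by (simp add: \<phi>_def \<Phi>_def p_def q_def min_def)
      next
        case False
        then show ?thesis using ab by (auto simp: \<phi>_def \<Phi>_def min_def)
      qed
    next
      fix a b' :: real assume "0 < a" "a \<le> b'"
      then show "\<phi> b' \<le> \<phi> a" by (auto simp: \<phi>_def intro!: divide_left_mono)
    qed (auto simp: \<phi>_def)
    also have "\<dots> \<le> (\<Sum>i<N. 2 * sqrt \<beta>)"
      using \<beta>(1) by (intro sum_mono) (auto simp: \<Phi>_def)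
    finally have phi_sum: "(\<Sum>i<N. utility T v y i * \<phi> (?u i)) \<le> 2 * real N * sqrt \<beta>"
      by simp
    \<comment> \<open>The 1 covers agents with utility above \<open>\<beta>\<close>; below it the
      benchmark gives at least \<open>\<beta>\<close>. The two ones and the bound 2 from
      \<open>phi_sum\<close> add up to the mean 4.\<close>
    have "sqrt (\<beta> / m i) \<le> 1 + utility T v y i * \<phi> (?u i) / sqrt \<beta>" if i: "i < N" for i
    proof (cases "?u i \<le> \<beta>")
      case True
      then have mi: "m i = ?u i" using \<mu>\<beta> by (simp add: m_def)
      have "sqrt (\<beta> / m i) = \<beta> / sqrt \<beta> * (1 / sqrt (?u i))"
        using \<beta>(1) by (simp add: mi real_sqrt_divide real_div_sqrt)
      also have "\<dots> = \<beta> * (1 / sqrt (?u i)) / sqrt \<beta>"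
        by (simp only: times_divide_eq_left)
      also have "\<dots> \<le> utility T v y i * (1 / sqrt (?u i)) / sqrt \<beta>"
        using \<beta>(2)[OF i] b[OF i] \<beta>(1) u_nonneg[OF i]
        by (intro divide_right_mono mult_right_mono) auto
      also have "\<dots> = utility T v y i * \<phi> (?u i) / sqrt \<beta>"
        using True u_nonneg[OF i] by (simp add: \<phi>_def)
      finally show ?thesis by simp
    next
      case False
      then have "\<beta> \<le> m i" using \<mu>\<beta> by (simp add: m_def)
      then have "sqrt (\<beta> / m i) \<le> 1" using \<beta>(1) by simp
      then show ?thesis using False by (simp add: \<phi>_def)
    qed
    then have "(\<Sum>i<N. 1 + sqrt (\<beta> / m i)) \<le>
        (\<Sum>i<N. 2 + utility T v y i * \<phi> (?u i) / sqrt \<beta>)"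
      by (intro sum_mono) force
    also have "\<dots> = 2 * real N + (\<Sum>i<N. utility T v y i * \<phi> (?u i)) / sqrt \<beta>"
      by (simp add: sum.distrib sum_divide_distrib)
    also have "\<dots> \<le> 2 * real N + 2 * real N * sqrt \<beta> / sqrt \<beta>"
      using phi_sum \<beta>(1) by (intro add_left_mono divide_right_mono) auto
    finally show ?thesis using \<beta>(1) by simp
  qed

  have large: "(\<Sum>i<N. b i / (\<beta> + m i)) \<le> real N * (1 + ln (1 + \<mu>))"
  proof -
    \<comment> \<open>The shift by \<open>\<beta>\<close> keeps \<open>\<Phi> 0 = ln \<beta>\<close>
      finite and the cut-off keeps \<open>\<Phi>\<close> at most
      \<open>ln (\<beta> * (1 + \<mu>))\<close>, so each agent contributes at most
      \<open>ln (1 + \<mu>)\<close>.\<close>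
    define \<phi> \<Phi> :: "real \<Rightarrow> real"
      where "\<phi> = (\<lambda>a. if a \<le> \<mu> * \<beta> then 1 / (\<beta> + \<bar>a\<bar>) else 0)"
        and "\<Phi> = (\<lambda>a. ln (\<beta> + min a (\<mu> * \<beta>)))"
    have "(\<Sum>i<N. utility T v y i * \<phi> (?u i)) \<le> (\<Sum>i<N. \<Phi> (?u i) - \<Phi> 0)"
    proof (rule potential)
      fix a b' :: real assume ab: "0 \<le> a" "a \<le> b'" "0 < b'"
      show "\<phi> b' * (b' - a) \<le> \<Phi> b' - \<Phi> a"
      proof (cases "b' \<le> \<mu> * \<beta>")
        case True
        have "ln ((\<beta> + a) / (\<beta> + b')) \<le> (\<beta> + a) / (\<beta> + b') - 1"
          using ab \<beta>(1) by (intro ln_le_minus_one) auto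
        also have "\<dots> = - ((b' - a) / (\<beta> + b'))"
          using ab \<beta>(1) by (simp add: field_simps)
        finally show ?thesis
          using True ab \<beta>(1) by (simp add: \<phi>_def \<Phi>_def min_def ln_div)
      next
        case False
        then show ?thesis using ab \<beta>(1) \<mu>\<beta> by (auto simp: \<phi>_def \<Phi>_def min_def)
      qed
    next
      fix a b' :: real assume "0 < a" "a \<le> b'"
      then show "\<phi> b' \<le> \<phi> a" using \<beta>(1) by (auto simp: \<phi>_def intro!: divide_left_mono)
    qed (use \<beta>(1) in \<open>auto simp: \<phi>_def\<close>)
    also have "\<dots> \<le> (\<Sum>i<N. ln (1 + \<mu>))"
    proof (rule sum_mono)
      fix i assume "i \<in> {..<N}"
      then have "?u i > 0" using u_pos by simp
      then have "\<Phi> (?u i) \<le> ln (\<beta> * (1 + \<mu>))"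
        using \<beta>(1) \<mu>\<beta> unfolding \<Phi>_def
        by (intro ln_mono) (auto simp: algebra_simps intro: add_pos_pos)
      also have "\<dots> = ln \<beta> + ln (1 + \<mu>)"
        using \<beta>(1) \<mu> by (simp add: ln_mult)
      finally show "\<Phi> (?u i) - \<Phi> 0 \<le> ln (1 + \<mu>)"
        using \<mu>\<beta> by (simp add: \<Phi>_def)
    qed
    finally have phi_sum: "(\<Sum>i<N. utility T v y i * \<phi> (?u i)) \<le> real N * ln (1 + \<mu>)"
      by simp
    \<comment> \<open>Beyond the cut-off \<open>m i = \<mu> * \<beta>\<close>, which is at least
      \<open>b i\<close>, so the 1 suffices.\<close>
    have "b i / (\<beta> + m i) \<le> 1 + utility T v y i * \<phi> (?u i)" if i: "i < N" for i
    proof (cases "?u i \<le> \<mu> * \<beta>")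
      case True
      then have "b i / (\<beta> + m i) = b i * \<phi> (?u i)"
        using u_nonneg[OF i] by (simp add: m_def \<phi>_def)
      also have "\<dots> \<le> utility T v y i * \<phi> (?u i)"
        using b[OF i] \<beta>(1) by (intro mult_right_mono) (auto simp: \<phi>_def)
      finally show ?thesis by simp
    next
      case False
      then have "b i \<le> \<beta> + m i" using \<beta>(1) \<beta>(3)[OF i] by (simp add: m_def)
      then have "b i / (\<beta> + m i) \<le> 1" using \<beta>(1) m_pos[OF i] by simp
      then show ?thesis using False by (simp add: \<phi>_def)
    qed
    then have "(\<Sum>i<N. b i / (\<beta> + m i)) \<le> (\<Sum>i<N. 1 + utility T v y i * \<phi> (?u i))"
      by (intro sum_mono) auto
    also have "\<dots> \<le> real N * (1 + ln (1 + \<mu>))"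
      using phi_sum by (simp add: sum.distrib algebra_simps)
    finally show ?thesis .
  qed

  have factor: "b i \<le> b i / (\<beta> + m i) * (1 + sqrt (\<beta> / m i))\<^sup>2 * ?u i" if i: "i < N" for i
  proof -
    have "(1 + \<beta> / m i) * m i = \<beta> + m i"
      using m_pos[OF i] by (simp add: field_simps)
    then have "b i = b i / (\<beta> + m i) * (1 + \<beta> / m i) * m i"
      using m_pos[OF i] \<beta>(1) by (simp add: mult.assoc)
    also have "\<dots> \<le> b i / (\<beta> + m i) * (1 + sqrt (\<beta> / m i))\<^sup>2 * ?u i"
      using m_pos[OF i] \<beta>(1) b_pos[OF i]
      by (intro mult_mono mult_left_mono) (auto simp: power2_sum m_def)
    finally show ?thesis .
  qed
  have "(\<Prod>i<N. b i) \<le> (\<Prod>i<N. b i / (\<beta> + m i) * (1 + sqrt (\<beta> / m i))\<^sup>2 * ?u i)"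
    using factor b_pos by (intro prod_mono) (auto intro: less_imp_le)
  also have "\<dots> = (\<Prod>i<N. b i / (\<beta> + m i)) * (\<Prod>i<N. 1 + sqrt (\<beta> / m i))\<^sup>2 * (\<Prod>i<N. ?u i)"
    by (simp only: prod.distrib prod_power_distrib)
  also have "\<dots> \<le> (1 + ln (1 + \<mu>)) ^ N * (4 ^ N)\<^sup>2 * (\<Prod>i<N. ?u i)"
  proof (intro mult_right_mono mult_mono power_mono)
    show "(\<Prod>i<N. b i / (\<beta> + m i)) \<le> (1 + ln (1 + \<mu>)) ^ N"
      using arith_geom_mean_power[of "{..<N}" "\<lambda>i. b i / (\<beta> + m i)"] large b_pos m_pos \<beta>(1)
      by (simp add: less_imp_le)
    show "(\<Prod>i<N. 1 + sqrt (\<beta> / m i)) \<le> 4 ^ N"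
      using arith_geom_mean_power[of "{..<N}" "\<lambda>i. 1 + sqrt (\<beta> / m i)" 4] small m_pos \<beta>(1)
      by (simp add: less_imp_le)
    show "0 \<le> (\<Prod>i<N. 1 + sqrt (\<beta> / m i))"
      using m_pos \<beta>(1) by (intro prod_nonneg) (auto intro!: add_nonneg_nonneg simp: less_imp_le)
    show "0 \<le> (\<Prod>i<N. ?u i)"
      using u_nonneg by (intro prod_nonneg) auto
    show "0 \<le> (1 + ln (1 + \<mu>)) ^ N"
      using \<mu> by (intro zero_le_power add_nonneg_nonneg) auto
  qed auto
  also have "\<dots> = (16 * (1 + ln (1 + \<mu>))) ^ N * (\<Prod>i<N. ?u i)"
  proof -
    have "(4 ^ N)\<^sup>2 = (16 :: real) ^ N"
      by (simp add: power2_eq_square flip: power_mult_distrib)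
    then show ?thesis by (simp only: power_mult_distrib mult.commute)
  qed
  finally show ?thesis .
qed

section \<open>Combining the bounds for the rounded instance\<close>

theorem theorem5:
  shows "\<exists>C::real. C > 0 \<and>
    (\<forall>(\<mu>::real) (N::nat) (T::nat) (s::nat \<Rightarrow> real)
        (v::nat \<Rightarrow> nat \<Rightarrow> real) (x::nat \<Rightarrow> nat \<Rightarrow> real).
       \<mu> \<ge> 2 \<longrightarrow> N \<ge> 1 \<longrightarrow> valid_instance N T s v \<longrightarrow>
       impartial_instance \<mu> N T s v \<longrightarrow>
       greedy_rounded_values \<mu> N T s v x \<longrightarrow>
       optimal_nash_welfare N T s v \<le> C * (log 2 \<mu>)\<^sup>2 * nash_welfare N T v x)"
proof (intro exI[of _ 192] conjI allI impI)
  fix \<mu> :: real and N T :: nat and s :: "nat \<Rightarrow> real" and v x :: "nat \<Rightarrow> nat \<Rightarrow> real"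
  assume \<mu>: "\<mu> \<ge> 2" and N: "N \<ge> 1" and v: "valid_instance N T s v"
    and impartial: "impartial_instance \<mu> N T s v"
    and greedy: "greedy_rounded_values \<mu> N T s v x"
  define L where "L = num_levels \<mu>"
  have log_ge_1: "log 2 \<mu> \<ge> 1"
    using \<mu> by (simp add: le_log_iff)
  \<comment> \<open>Rounding up at most doubles the logarithm because it is at least 1.\<close>
  have L: "L \<ge> 1" "log 2 \<mu> \<le> real L" "real L \<le> 2 * log 2 \<mu>"
    using log_ge_1 by (auto simp: L_def num_levels_def) linarith+
  have \<mu>_le: "\<mu> \<le> 2 ^ L"
    using L(2) \<mu> by (simp add: log_le_iff powr_realpow)
  obtain z where z: "myopic_greedy N (T * L) (rounded_supply L s) (rounded_value N L v) z"
    and x: "\<And>i t. i < N \<Longrightarrow> t < T \<Longrightarrow> x i t = (\<Sum>j=1..L. z i (t * L + (j - 1)))"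
    using greedy by (auto simp: greedy_rounded_values_def Let_def L_def)
  have div_less: "k div L < T" if "k < T * L" for k
    using that by (simp add: less_mult_imp_div_less)
  have s: "rounded_supply L s k > 0" if "k < T * L" for k
    using v L(1) div_less[OF that] by (simp add: rounded_supply_def valid_instance_def)
  have max_nonneg: "max_value N v t \<ge> 0" if "t < T" for t
    using max_value_ge[of 0 N v t] N v that by (force simp: valid_instance_def)
  have z_nonneg: "z i k \<ge> 0" if "i < N" "k < T * L" for i k
    using z that by (auto simp: myopic_greedy_def feasible_split_def)
  have r_nonneg: "rounded_value N L v i k \<ge> 0" if "k < T * L" for i k
    using max_nonneg[OF div_less[OF that]] by (simp add: rounded_value_def Let_def)
  have greedy_utility: "0 \<le> utility (T * L) (rounded_value N L v) z i"
    "utility (T * L) (rounded_value N L v) z i \<le> utility T v x i" if "i < N" for i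
  proof -
    show "0 \<le> utility (T * L) (rounded_value N L v) z i"
      unfolding utility_def using that z_nonneg r_nonneg by (intro sum_nonneg) auto
    show "utility (T * L) (rounded_value N L v) z i \<le> utility T v x i"
      using that by (intro rounded_utility_le[OF v] z_nonneg x)
  qed
  then have x_utility_nonneg: "0 \<le> utility T v x i" if "i < N" for i
    using that order_trans by blast
  obtain opt where opt: "nash_maximizing N T s v opt"
    using nash_maximizing_exists[OF v] .
  then have o_alloc: "allocation N T s opt" by (simp add: nash_maximizing_def)
  let ?u = "utility T v opt"
  have o_nonneg: "?u i \<ge> 0" if "i < N" for i
    unfolding utility_def using o_alloc v that
    by (intro sum_nonneg) (auto simp: allocation_def feasible_split_def valid_instance_def)
  have "optimal_nash_welfare N T s v \<le> nash_welfare N T v opt"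
    unfolding optimal_nash_welfare_def
    using opt o_alloc by (intro cSUP_least) (auto simp: nash_maximizing_def)
  also have "\<dots> \<le> 192 * (log 2 \<mu>)\<^sup>2 * nash_welfare N T v x"
  \<comment> \<open>The exchange inequality needs positive optimal utilities; if one vanishes, the
    optimal welfare is 0.\<close>
  proof (cases "\<forall>i<N. ?u i > 0")
    case False
    then have "\<exists>i<N. ?u i = 0"
      using o_nonneg by force
    then have "(\<Prod>i<N. ?u i) = 0"
      by (intro prod_zero) auto
    then have "nash_welfare N T v opt = 0"
      unfolding nash_welfare_def by (simp only: real_root_zero)
    moreover have "nash_welfare N T v x \<ge> 0"
      unfolding nash_welfare_def using x_utility_nonneg
      by (intro real_root_ge_zero prod_nonneg) auto
    ultimately show ?thesis by simp
  next
    case True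
    have impartial_o: "?u i \<le> \<mu> * ?u j" if "i < N" "j < N" for i j
      using impartial opt that by (auto simp: impartial_instance_def impartial_allocation_def)
    \<comment> \<open>Comparing \<open>i\<close> with an agent \<open>j\<close> of maximal value,
      the exchange inequality and \<open>?u j \<le> \<mu> * ?u i\<close> limit the loss to
      \<open>2 ^ L\<close>. This is why \<open>L\<close> levels suffice.\<close>
    have near_max: "max_value N v t / 2 ^ L \<le> v i t" if i: "i < N" and t: "t < T" "opt i t > 0" for i t
    proof -
      obtain j where j: "j < N" "max_value N v t = v j t"
        using max_value_attained[OF N] .
      have vi: "v i t \<ge> 0" using v i t by (auto simp: valid_instance_def)
      have "v j t * ?u i \<le> v i t * ?u j"
        using nash_maximizing_exchange[OF opt v _ i j(1) t] True by blast
      also have "\<dots> \<le> v i t * (2 ^ L * ?u i)"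
      proof (rule mult_left_mono[OF _ vi])
        have "?u j \<le> \<mu> * ?u i" using impartial_o i j by blast
        also have "\<dots> \<le> 2 ^ L * ?u i"
          using \<mu>_le o_nonneg[OF i] by (rule mult_right_mono)
        finally show "?u j \<le> 2 ^ L * ?u i" .
      qed
      finally have "v j t \<le> v i t * 2 ^ L"
        using True i by (simp add: mult.assoc[symmetric])
      then show ?thesis
        by (simp add: j(2) field_simps)
    qed
    define b where "b i = ?u i / (2 * real L)" for i
    define y where "y i k = opt i (k div L) / real L" for i k
    define \<beta> where "\<beta> = Min (b ` {..<N})"
    have y: "allocation N (T * L) (rounded_supply L s) y"
      using o_alloc div_less L(1)
      by (auto simp: allocation_def feasible_split_def y_def rounded_supply_def
          divide_right_mono simp flip: sum_divide_distrib)
    have "b ` {..<N} \<noteq> {}" using N by (auto simp: lessThan_empty_iff)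
    then have "\<beta> \<in> b ` {..<N}" unfolding \<beta>_def by (intro Min_in) auto
    then obtain m where m: "m < N" "\<beta> = b m" by auto
    have "(\<Prod>i<N. b i) \<le> (16 * (1 + ln (1 + \<mu>))) ^ N *
        (\<Prod>i<N. utility (T * L) (rounded_value N L v) z i)"
    proof (rule myopic_greedy_competitive[OF z s _ _ y])
      fix k assume "k < T * L"
      then show "0 \<le> max_value N v (k div L) / 2 ^ (k mod L + 1)"
        using max_nonneg[OF div_less] by simp
    next
      fix i k assume "i < N" "k < T * L"
      show "rounded_value N L v i k = 0 \<or>
          rounded_value N L v i k = max_value N v (k div L) / 2 ^ (k mod L + 1)"
        by (simp add: rounded_value_def Let_def)
    next
      fix i assume i: "i < N"
      show "b i \<le> utility (T * L) (rounded_value N L v) y i"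
        unfolding b_def y_def
        using half_utility_le_rounded_utility[OF L(1) v o_alloc i near_max[OF i]] .
      show "\<beta> \<le> b i" using i by (simp add: \<beta>_def)
      have "b i \<le> \<mu> * ?u m / (2 * real L)"
        unfolding b_def using impartial_o[OF i m(1)] by (intro divide_right_mono) auto
      then show "b i \<le> \<mu> * \<beta>" by (simp add: m(2) b_def)
    next
      show "\<beta> > 0" using True m L(1) by (simp add: b_def)
    qed (use \<mu> in auto)
    also have "\<dots> \<le> (16 * (1 + ln (1 + \<mu>))) ^ N * (\<Prod>i<N. utility T v x i)"
      using greedy_utility \<mu> by (intro mult_left_mono prod_mono zero_le_power) auto
    also have "(\<Prod>i<N. b i) = (\<Prod>i<N. ?u i) / (2 * real L) ^ N"
      by (simp add: b_def prod_dividef)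
    finally have "(\<Prod>i<N. ?u i) \<le>
        (2 * real L) ^ N * ((16 * (1 + ln (1 + \<mu>))) ^ N * (\<Prod>i<N. utility T v x i))"
      using L(1) by (simp add: divide_le_eq mult.commute)
    also have "\<dots> = (2 * real L * (16 * (1 + ln (1 + \<mu>)))) ^ N * (\<Prod>i<N. utility T v x i)"
      by (simp only: power_mult_distrib mult.assoc)
    also have "2 * real L * (16 * (1 + ln (1 + \<mu>))) = 32 * real L * (1 + ln (1 + \<mu>))"
      by simp
    finally have "root N (\<Prod>i<N. ?u i) \<le>
        root N ((32 * real L * (1 + ln (1 + \<mu>))) ^ N * (\<Prod>i<N. utility T v x i))"
      using N by (intro real_root_le_mono) auto
    then have "nash_welfare N T v opt \<le> 32 * real L * (1 + ln (1 + \<mu>)) * nash_welfare N T v x"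
      using N \<mu> by (simp add: nash_welfare_def real_root_mult real_root_power_cancel)
    \<comment> \<open>The constant 192 is \<open>32 * 2 * 3\<close>: 32 combines the 2 in the
      definition of \<open>b\<close> with the 16 of the product bound, 2 comes from rounding up
      \<open>L\<close>, and 3 from \<open>1 + 2 * ln \<mu> \<le> 3 * log 2 \<mu>\<close>.\<close>
    also have "\<dots> \<le> 32 * (2 * log 2 \<mu>) * (3 * log 2 \<mu>) * nash_welfare N T v x"
    proof (intro mult_right_mono mult_mono)
      have "ln (1 + \<mu>) \<le> ln (\<mu>\<^sup>2)"
      proof (subst ln_le_cancel_iff)
        have "2 * \<mu> \<le> \<mu> * \<mu>" using \<mu> by (intro mult_right_mono) auto
        then show "1 + \<mu> \<le> \<mu>\<^sup>2" using \<mu> unfolding power2_eq_square by linarith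
      qed (use \<mu> in auto)
      also have "\<dots> = 2 * ln \<mu>" using \<mu> by (simp add: ln_realpow)
      also have "ln \<mu> = log 2 \<mu> * ln 2" by (simp add: log_def)
      also have "2 * (log 2 \<mu> * ln 2) \<le> 2 * log 2 \<mu>"
        using log_ge_1 ln_2_less_1 by (intro mult_left_mono mult_left_le) auto
      finally show "1 + ln (1 + \<mu>) \<le> 3 * log 2 \<mu>" using log_ge_1 by simp
      show "0 \<le> nash_welfare N T v x"
        unfolding nash_welfare_def using x_utility_nonneg
        by (intro real_root_ge_zero prod_nonneg) auto
    qed (use L log_ge_1 \<mu> in auto)
    finally show ?thesis by (simp add: power2_eq_square mult_ac)
  qed
  finally show "optimal_nash_welfare N T s v \<le> 192 * (log 2 \<mu>)\<^sup>2 * nash_welfare N T v x" .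
qed simp

end
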